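(* A finite lattice $L$ is join-semidistributive if and only if the projection $\mathrm{pr}_0:\mathrm{Cov}(L)\to L$, $\gamma\mapsto\gamma_0$, creates pullbacks.
   Context: A lattice is join-semidistributive if $x\vee y = x\vee z$ implies $x \vee (y\wedge z) = x\vee y$. For a finite lattice $L$, $\mathrm{Cov}(L)$ is the set of covers, i.e. pairs $\gamma=(\gamma_0,\gamma_1)\in L^2$ such that $\gamma_0<\gamma_1$ with no element strictly between, partially ordered by: $\gamma\le\delta$ iff $\gamma_0\le\delta_0$, $\gamma_1\not\le\delta_0$ and $\gamma_1\le\delta_1$. An order preserving function $\pi:P\to Q$ between posets creates pullbacks if, whenever $x,y,z\in P$ are such that $x,y\le z$ and the meet $\pi(x)\wedge\pi(y)$ exists in $Q$, there exists a unique $u\le x,y$ such that $\pi(u)=\pi(x)\wedge\pi(y)$, and moreover $u=x\wedge y$ (the meet of $x$ and $y$ in $P$). *)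

theory Defs
  imports "HOL-Algebra.Lattice"
begin

definition join_semidistributive :: "('a, 'm) gorder_scheme \<Rightarrow> bool" where
  "join_semidistributive L \<longleftrightarrow>
     (\<forall>x\<in>carrier L. \<forall>y\<in>carrier L. \<forall>z\<in>carrier L.
        x \<squnion>\<^bsub>L\<^esub> y = x \<squnion>\<^bsub>L\<^esub> z \<longrightarrow> x \<squnion>\<^bsub>L\<^esub> (y \<sqinter>\<^bsub>L\<^esub> z) = x \<squnion>\<^bsub>L\<^esub> y)"

definition covers :: "('a, 'm) gorder_scheme \<Rightarrow> ('a \<times> 'a) set" where
  "covers L =
     {(c0, c1). c0 \<in> carrier L \<and> c1 \<in> carrier L \<and> c0 \<sqsubset>\<^bsub>L\<^esub> c1 \<and>
        \<not> (\<exists>x\<in>carrier L. c0 \<sqsubset>\<^bsub>L\<^esub> x \<and> x \<sqsubset>\<^bsub>L\<^esub> c1)}"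

definition Cov :: "('a, 'm) gorder_scheme \<Rightarrow> ('a \<times> 'a) gorder" where
  "Cov L =
     \<lparr> carrier = covers L,
       eq = (=),
       le = (\<lambda>c d. fst c \<sqsubseteq>\<^bsub>L\<^esub> fst d \<and> \<not> snd c \<sqsubseteq>\<^bsub>L\<^esub> fst d \<and> snd c \<sqsubseteq>\<^bsub>L\<^esub> snd d) \<rparr>"

text \<open>
  The first line says that \<open>p\<close> is an order preserving map between posets.
  The constant \<^const>\<open>isotone\<close> alone does not demand that \<open>p\<close> maps the carrier of \<open>P\<close>
  into that of \<open>Q\<close>, nor that the equivalence of either structure is equality.
  Meets of \<open>P\<close> and \<open>Q\<close> need not exist, so they are expressed by \<^const>\<open>is_glb\<close>
  and not by the operation \<^const>\<open>meet\<close>.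
\<close>

definition creates_pullbacks ::
    "('a, 'm) gorder_scheme \<Rightarrow> ('b, 'n) gorder_scheme \<Rightarrow> ('a \<Rightarrow> 'b) \<Rightarrow> bool" where
  "creates_pullbacks P Q p \<longleftrightarrow>
     partial_order P \<and> partial_order Q \<and> p \<in> carrier P \<rightarrow> carrier Q \<and> isotone P Q p \<and>
     (\<forall>x\<in>carrier P. \<forall>y\<in>carrier P. \<forall>z\<in>carrier P. \<forall>m.
        x \<sqsubseteq>\<^bsub>P\<^esub> z \<and> y \<sqsubseteq>\<^bsub>P\<^esub> z \<and> is_glb Q m {p x, p y} \<longrightarrow>
        (\<exists>!u. u \<in> carrier P \<and> u \<sqsubseteq>\<^bsub>P\<^esub> x \<and> u \<sqsubseteq>\<^bsub>P\<^esub> y \<and> p u = m) \<and>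
        (\<forall>u\<in>carrier P. u \<sqsubseteq>\<^bsub>P\<^esub> x \<and> u \<sqsubseteq>\<^bsub>P\<^esub> y \<and> p u = m \<longrightarrow> is_glb P u {x, y}))"

text \<open>
  The side conditions of \<^const>\<open>creates_pullbacks\<close> always hold for the projection
  \<^term>\<open>fst\<close> from \<^term>\<open>Cov L\<close> to a lattice \<^term>\<open>L\<close>.
\<close>

lemma partial_order_Cov:
  assumes "lattice L"
  shows "partial_order (Cov L)"
proof -
  interpret lattice L by fact
  have trans: "\<not> c1 \<sqsubseteq>\<^bsub>L\<^esub> e0"
    if c: "c1 \<in> carrier L" "c1 \<sqsubseteq>\<^bsub>L\<^esub> d1" "\<not> c1 \<sqsubseteq>\<^bsub>L\<^esub> d0"
      and d: "(d0, d1) \<in> covers L" "d0 \<sqsubseteq>\<^bsub>L\<^esub> e0" "\<not> d1 \<sqsubseteq>\<^bsub>L\<^esub> e0"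
      and e: "e0 \<in> carrier L" for c1 d0 d1 e0
  proof
    assume le: "c1 \<sqsubseteq>\<^bsub>L\<^esub> e0"
    define w where "w = e0 \<sqinter>\<^bsub>L\<^esub> d1"
    have dL: "d0 \<in> carrier L" "d1 \<in> carrier L" "d0 \<sqsubseteq>\<^bsub>L\<^esub> d1"
      using d by (auto simp: covers_def lless_def)
    have w: "w \<in> carrier L" "w \<sqsubseteq>\<^bsub>L\<^esub> e0" "w \<sqsubseteq>\<^bsub>L\<^esub> d1" "d0 \<sqsubseteq>\<^bsub>L\<^esub> w" "c1 \<sqsubseteq>\<^bsub>L\<^esub> w"
      using dL c d e le by (auto simp: w_def meet_left meet_right meet_le)
    have "w \<noteq> d1" "w \<noteq> d0" using w d c by auto
    then show False using w dL d by (auto simp: covers_def lless_def eq_is_equal)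
  qed
  show ?thesis
  proof (unfold_locales)
    fix x y z assume xyz: "x \<sqsubseteq>\<^bsub>Cov L\<^esub> y" "y \<sqsubseteq>\<^bsub>Cov L\<^esub> z"
      "x \<in> carrier (Cov L)" "y \<in> carrier (Cov L)" "z \<in> carrier (Cov L)"
    show "x \<sqsubseteq>\<^bsub>Cov L\<^esub> z"
      using xyz trans[of "snd x" "snd y" "fst y" "fst z"]
      by (cases x; cases y; cases z) (auto simp: Cov_def covers_def intro: le_trans)
  qed (auto simp: Cov_def covers_def lless_def eq_is_equal intro: le_antisym le_trans)
qed

lemma isotone_fst_Cov:
  assumes "lattice L"
  shows "fst \<in> carrier (Cov L) \<rightarrow> carrier L" and "isotone (Cov L) L fst"
proof -
  interpret lattice L by fact
  interpret C: partial_order "Cov L" using assms by (rule partial_order_Cov)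
  show "fst \<in> carrier (Cov L) \<rightarrow> carrier L" by (auto simp: Cov_def covers_def)
  show "isotone (Cov L) L fst"
    using weak_partial_order_axioms C.weak_partial_order_axioms
    by (auto simp: isotone_def Cov_def)
qed

end

theory Submission
  imports Defs
begin

text \<open>
  Covers \<open>\<gamma> \<le> \<delta>\<close> satisfy \<open>\<delta>\<^sub>1 = \<delta>\<^sub>0 \<squnion> \<gamma>\<^sub>1\<close>. If \<open>L\<close> is join-semidistributive, then for each cover
  \<open>\<zeta>\<close> the set \<open>{a \<le> \<zeta>\<^sub>1. \<not> a \<le> \<zeta>\<^sub>0}\<close> is closed under meets, so it has a least element \<open>j\<close>, and
  \<open>j\<close> plays the same role for every cover below \<open>\<zeta>\<close>. Hence the only candidate for the
  pullback of \<open>\<gamma>, \<delta> \<le> \<zeta>\<close> over \<open>m = \<gamma>\<^sub>0 \<sqinter> \<delta>\<^sub>0\<close> is \<open>(m, m \<squnion> j)\<close>, and it works.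

  Conversely, a failure of join-semidistributivity can be enlarged to one of the form \<open>x \<prec> t\<close>,
  \<open>x \<squnion> y = x \<squnion> z = t\<close>, \<open>y \<sqinter> z \<le> x\<close>. Taking \<open>y\<^sub>1 \<le> y\<close> and \<open>z\<^sub>1 \<le> z\<close> minimal not below \<open>x\<close>
  yields covers \<open>(x \<sqinter> y\<^sub>1, y\<^sub>1)\<close> and \<open>(x \<sqinter> z\<^sub>1, z\<^sub>1)\<close> below \<open>(x, t)\<close>. Their bottoms meet in
  \<open>y\<^sub>1 \<sqinter> z\<^sub>1\<close>, so no cover with this bottom lies below both.
\<close>

section \<open>Extremal elements of finite sets and meets of pairs\<close>

lemma (in partial_order) finite_has_minimal:
  assumes "finite S" "S \<noteq> {}" "S \<subseteq> carrier L"
  obtains s where "s \<in> S" "\<And>a. a \<in> S \<Longrightarrow> a \<sqsubseteq> s \<Longrightarrow> a = s"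
proof -
  have "asymp_on S (\<lambda>a b. a \<sqsubset> b)" "transp_on S (\<lambda>a b. a \<sqsubset> b)"
    using assms(3) by (auto simp: asymp_on_def transp_on_def lless_eq intro: le_antisym le_trans)
  from Finite_Set.bex_min_element[OF assms(1) this assms(2)] show thesis
    using that by (auto simp: lless_eq)
qed

lemma (in partial_order) finite_has_maximal:
  assumes "finite S" "S \<noteq> {}" "S \<subseteq> carrier L"
  obtains s where "s \<in> S" "\<And>a. a \<in> S \<Longrightarrow> s \<sqsubseteq> a \<Longrightarrow> a = s"
proof -
  have "asymp_on S (\<lambda>a b. a \<sqsubset> b)" "transp_on S (\<lambda>a b. a \<sqsubset> b)"
    using assms(3) by (auto simp: asymp_on_def transp_on_def lless_eq intro: le_antisym le_trans)
  from Finite_Set.bex_max_element[OF assms(1) this assms(2)] show thesis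
    using that by (auto simp: lless_eq)
qed

text \<open>\<open>creates_pullbacks\<close> expresses meets through \<open>is_glb\<close>; this
  translates them into the lattice operation.\<close>

lemma (in lattice) is_glb_pair_iff:
  assumes "x \<in> carrier L" "y \<in> carrier L"
  shows "is_glb L m {x, y} \<longleftrightarrow> m = x \<sqinter> y"
proof -
  have "is_glb L (x \<sqinter> y) {x, y}"
    using inf_of_two_exists[OF assms] unfolding meet_def inf_def by (rule someI_ex)
  then show ?thesis by (metis greatest_unique)
qed

section \<open>Covers and the elements that generate them\<close>

context partial_order
begin

lemma coversI:
  assumes "c0 \<in> carrier L" "c1 \<in> carrier L" "c0 \<sqsubseteq> c1" "c0 \<noteq> c1"
    and "\<And>a. a \<in> carrier L \<Longrightarrow> c0 \<sqsubseteq> a \<Longrightarrow> a \<sqsubseteq> c1 \<Longrightarrow> a \<noteq> c1 \<Longrightarrow> a = c0"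
  shows "(c0, c1) \<in> covers L"
  using assms by (auto simp: covers_def lless_eq)

lemma coversD:
  assumes "(c0, c1) \<in> covers L"
  shows "c0 \<in> carrier L" "c1 \<in> carrier L" "c0 \<sqsubseteq> c1" "\<not> c1 \<sqsubseteq> c0"
    and "\<And>a. a \<in> carrier L \<Longrightarrow> c0 \<sqsubseteq> a \<Longrightarrow> a \<sqsubseteq> c1 \<Longrightarrow> a = c0 \<or> a = c1"
  using assms by (auto simp: covers_def lless_eq intro: le_antisym)

end

context lattice
begin

text \<open>Joining \<open>a\<close> to \<open>c0\<close> stays below \<open>c1\<close> and moves
  strictly above \<open>c0\<close>, so the cover property leaves only \<open>c1\<close>.\<close>

lemma covers_join_eq:
  assumes c: "(c0, c1) \<in> covers L" and a: "a \<in> carrier L" "a \<sqsubseteq> c1" "\<not> a \<sqsubseteq> c0"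
  shows "c0 \<squnion> a = c1"
  by (metis a c coversD(1-3,5) join_closed join_le join_left join_right)

text \<open>Any two elements below \<open>c1\<close> but not below \<open>c0\<close> have the same
  join \<open>c1\<close> with \<open>c0\<close>. Join-semidistributivity gives their meet that join
  too, so the meet is again not below \<open>c0\<close>. A minimal such element is therefore
  least.\<close>

lemma join_semidistributive_least:
  assumes jsd: "join_semidistributive L" and fin: "finite (carrier L)"
    and c: "(c0, c1) \<in> covers L"
  obtains j where "j \<in> carrier L" "j \<sqsubseteq> c1" "\<not> j \<sqsubseteq> c0"
    and "\<And>a. a \<in> carrier L \<Longrightarrow> a \<sqsubseteq> c1 \<Longrightarrow> \<not> a \<sqsubseteq> c0 \<Longrightarrow> j \<sqsubseteq> a"
proof -
  let ?S = "{a \<in> carrier L. a \<sqsubseteq> c1 \<and> \<not> a \<sqsubseteq> c0}"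
  note cD = coversD[OF c]
  obtain j where j: "j \<in> ?S" and min: "\<And>a. a \<in> ?S \<Longrightarrow> a \<sqsubseteq> j \<Longrightarrow> a = j"
    by (rule finite_has_minimal[of ?S]) (use fin cD in auto)
  have "j \<sqsubseteq> a" if a: "a \<in> ?S" for a
  proof -
    have "c0 \<squnion> j = c1" "c0 \<squnion> a = c1" using covers_join_eq[OF c] a j by auto
    then have eq: "c0 \<squnion> (j \<sqinter> a) = c1"
      using jsd a j cD unfolding join_semidistributive_def by auto
    have "\<not> j \<sqinter> a \<sqsubseteq> c0"
      using eq a j cD by (metis (no_types, lifting) join_le le_refl mem_Collect_eq meet_closed)
    moreover have "j \<sqinter> a \<sqsubseteq> j" using a j by (auto intro: meet_left)
    moreover from this have "j \<sqinter> a \<sqsubseteq> c1"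
      using a j cD by (auto intro: le_trans[of _ j])
    ultimately have "j \<sqinter> a = j" using a j by (intro min) auto
    then show ?thesis using a j meet_right[of j a] by auto
  qed
  then show thesis using j that by auto
qed

text \<open>For a minimal element \<open>s\<close> below \<open>y\<close> but not below
  \<open>x\<close>, everything strictly below \<open>s\<close> lies below \<open>x\<close>. Hence
  \<open>x \<sqinter> s\<close> is the largest element strictly below \<open>s\<close>.\<close>

lemma minimal_not_below:
  assumes fin: "finite (carrier L)" and c: "x \<in> carrier L" "y \<in> carrier L" "\<not> y \<sqsubseteq> x"
  obtains y1 where "y1 \<in> carrier L" "y1 \<sqsubseteq> y" "\<not> y1 \<sqsubseteq> x" "(x \<sqinter> y1, y1) \<in> covers L"
proof -
  let ?S = "{a \<in> carrier L. a \<sqsubseteq> y \<and> \<not> a \<sqsubseteq> x}"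
  obtain s where s: "s \<in> ?S" and min: "\<And>a. a \<in> ?S \<Longrightarrow> a \<sqsubseteq> s \<Longrightarrow> a = s"
    by (rule finite_has_minimal[of ?S]) (use fin c in auto)
  have "(x \<sqinter> s, s) \<in> covers L"
  proof (rule coversI)
    show "x \<sqinter> s \<noteq> s" using s c meet_left[of x s] by auto
    fix a assume a: "a \<in> carrier L" "x \<sqinter> s \<sqsubseteq> a" "a \<sqsubseteq> s" "a \<noteq> s"
    have "a \<sqsubseteq> y" using a s c by (auto intro: le_trans[of _ s])
    then have "a \<sqsubseteq> x" using min a by auto
    then have "a \<sqsubseteq> x \<sqinter> s" using a s c by (auto intro: meet_le)
    then show "a = x \<sqinter> s" using a s c by (auto intro: le_antisym)
  qed (use s c meet_right in auto)
  then show thesis using s that by auto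
qed

lemma lower_cover_above:
  assumes fin: "finite (carrier L)" and c: "x \<in> carrier L" "t \<in> carrier L" "x \<sqsubseteq> t" "x \<noteq> t"
  obtains x' where "x \<sqsubseteq> x'" "(x', t) \<in> covers L"
proof -
  let ?S = "{a \<in> carrier L. x \<sqsubseteq> a \<and> a \<sqsubseteq> t \<and> a \<noteq> t}"
  obtain s where s: "s \<in> ?S" and max: "\<And>a. a \<in> ?S \<Longrightarrow> s \<sqsubseteq> a \<Longrightarrow> a = s"
    by (rule finite_has_maximal[of ?S]) (use fin c in auto)
  have "(s, t) \<in> covers L"
  proof (rule coversI)
    fix a assume a: "a \<in> carrier L" "s \<sqsubseteq> a" "a \<sqsubseteq> t" "a \<noteq> t"
    have "x \<sqsubseteq> a" using a s c by (auto intro: le_trans[of _ s])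
    then show "a = s" using a max by auto
  qed (use s c in auto)
  then show thesis using s that by auto
qed

section \<open>Pullbacks of covers in a join-semidistributive lattice\<close>

lemma Cov_le_pair:
  "(c0, c1) \<sqsubseteq>\<^bsub>Cov L\<^esub> (d0, d1) \<longleftrightarrow> c0 \<sqsubseteq> d0 \<and> \<not> c1 \<sqsubseteq> d0 \<and> c1 \<sqsubseteq> d1"
  by (simp add: Cov_def)

lemma carrier_Cov [simp]: "carrier (Cov L) = covers L"
  by (simp add: Cov_def)

text \<open>The bound \<open>j\<close> passes from a cover to each cover below it: if
  \<open>a\<close> were below \<open>z0\<close>, then \<open>x1 = x0 \<squnion> a\<close> would be
  as well, against \<open>xz\<close>.\<close>

lemma least_of_lower_cover:
  assumes z: "(z0, z1) \<in> covers L" and x: "(x0, x1) \<in> covers L"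
    and xz: "(x0, x1) \<sqsubseteq>\<^bsub>Cov L\<^esub> (z0, z1)"
    and j: "\<And>a. a \<in> carrier L \<Longrightarrow> a \<sqsubseteq> z1 \<Longrightarrow> \<not> a \<sqsubseteq> z0 \<Longrightarrow> j \<sqsubseteq> a"
    and a: "a \<in> carrier L" "a \<sqsubseteq> x1" "\<not> a \<sqsubseteq> x0"
  shows "j \<sqsubseteq> a"
proof (rule j)
  note D = coversD[OF z] coversD[OF x] xz[unfolded Cov_le_pair]
  show "a \<sqsubseteq> z1" using D a by (auto intro: le_trans[of _ x1])
  have "x0 \<squnion> a = x1" by (rule covers_join_eq[OF x a])
  then show "\<not> a \<sqsubseteq> z0" using D a join_le[of x0 z0 a] by auto
qed (rule a)

lemma join_semidistributive_pullback:
  assumes jsd: "join_semidistributive L" and fin: "finite (carrier L)"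
    and x: "(x0, x1) \<in> covers L" and y: "(y0, y1) \<in> covers L" and z: "(z0, z1) \<in> covers L"
    and xz: "(x0, x1) \<sqsubseteq>\<^bsub>Cov L\<^esub> (z0, z1)" and yz: "(y0, y1) \<sqsubseteq>\<^bsub>Cov L\<^esub> (z0, z1)"
  obtains u1 where "(x0 \<sqinter> y0, u1) \<in> covers L"
    "is_glb (Cov L) (x0 \<sqinter> y0, u1) {(x0, x1), (y0, y1)}"
    "\<And>v. (x0 \<sqinter> y0, v) \<in> covers L \<Longrightarrow> (x0 \<sqinter> y0, v) \<sqsubseteq>\<^bsub>Cov L\<^esub> (x0, x1) \<Longrightarrow> v = u1"
proof -
  interpret C: partial_order "Cov L" by (rule partial_order_Cov) (rule lattice_axioms)
  obtain j where j: "j \<in> carrier L" "j \<sqsubseteq> z1" "\<not> j \<sqsubseteq> z0"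
    and least: "\<And>a. a \<in> carrier L \<Longrightarrow> a \<sqsubseteq> z1 \<Longrightarrow> \<not> a \<sqsubseteq> z0 \<Longrightarrow> j \<sqsubseteq> a"
    using join_semidistributive_least[OF jsd fin z] by blast
  note leastx = least_of_lower_cover[OF z x xz least]
    and leasty = least_of_lower_cover[OF z y yz least]
  note D = coversD(1-4)[OF x] coversD(1-4)[OF y] coversD(1-4)[OF z]
    xz[unfolded Cov_le_pair] yz[unfolded Cov_le_pair]
  define m where "m = x0 \<sqinter> y0"
  define u1 where "u1 = m \<squnion> j"
  have m: "m \<in> carrier L" "m \<sqsubseteq> x0" "m \<sqsubseteq> y0"
    using D by (auto simp: m_def meet_left meet_right)
  have mx: "m \<sqsubseteq> x1" "m \<sqsubseteq> y1"
    using m D by (auto intro: le_trans[of _ x0] le_trans[of _ y0])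
  \<comment> \<open>\<open>x1\<close> and \<open>y1\<close> are themselves below \<open>z1\<close>
    and not below \<open>z0\<close>, so \<open>j\<close> bounds them from below. Since
    \<open>x0\<close> and \<open>y0\<close> lie below \<open>z0\<close>, neither is above
    \<open>j\<close>.\<close>
  have jx: "j \<sqsubseteq> x1" "j \<sqsubseteq> y1" "\<not> j \<sqsubseteq> x0" "\<not> j \<sqsubseteq> y0"
    using least D j le_trans[of j x0 z0] le_trans[of j y0 z0] by auto
  have u: "u1 \<in> carrier L" "m \<sqsubseteq> u1" "j \<sqsubseteq> u1" "u1 \<sqsubseteq> x1" "u1 \<sqsubseteq> y1"
    using m mx j jx D by (auto simp: u1_def join_left join_right intro: join_le)
  have ux: "\<not> u1 \<sqsubseteq> x0" "\<not> u1 \<sqsubseteq> y0"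
    using u jx j D le_trans[of j u1] by auto
  have ucov: "(m, u1) \<in> covers L"
  proof (rule coversI)
    show "m \<noteq> u1" using ux m by auto
    fix a assume a: "a \<in> carrier L" "m \<sqsubseteq> a" "a \<sqsubseteq> u1" "a \<noteq> u1"
    \<comment> \<open>Otherwise \<open>a\<close> would be above \<open>m \<squnion> j = u1\<close>.
      By the contrapositives of \<open>leastx\<close> and \<open>leasty\<close>, \<open>a\<close>
      then falls below \<open>x0\<close> and \<open>y0\<close>, hence below
      \<open>m\<close>.\<close>
    have "\<not> j \<sqsubseteq> a"
      using a u m j join_le[of m a j] by (auto simp: u1_def intro: le_antisym)
    moreover have "a \<sqsubseteq> x1" "a \<sqsubseteq> y1" using a u D by (auto intro: le_trans[of _ u1])
    ultimately have "a \<sqsubseteq> x0" "a \<sqsubseteq> y0" using leastx leasty a by auto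
    then have "a \<sqsubseteq> m" unfolding m_def using a D by (auto intro: meet_le)
    then show "a = m" using a m by (auto intro: le_antisym)
  qed (use m u in auto)
  have "is_glb (Cov L) (m, u1) {(x0, x1), (y0, y1)}"
  proof (rule greatest_LowerI)
    fix c assume "c \<in> Lower (Cov L) {(x0, x1), (y0, y1)}"
    then obtain c0 c1 where [simp]: "c = (c0, c1)" and c: "(c0, c1) \<in> covers L"
      and cx: "(c0, c1) \<sqsubseteq>\<^bsub>Cov L\<^esub> (x0, x1)" and cy: "(c0, c1) \<sqsubseteq>\<^bsub>Cov L\<^esub> (y0, y1)"
      using x y by (cases c) (auto simp: Lower_def)
    note cD = coversD(1-4)[OF c] cx[unfolded Cov_le_pair] cy[unfolded Cov_le_pair]
    have cm: "c0 \<sqsubseteq> m" unfolding m_def using cD D by (auto intro: meet_le)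
    \<comment> \<open>A cover below \<open>(x0, x1)\<close> has its top generated by its bottom and
      \<open>j\<close>, so comparing it with \<open>(m, u1)\<close> reduces to comparing
      \<open>c0\<close> with \<open>m\<close>.\<close>
    have "j \<sqsubseteq> c1" using leastx cD by auto
    moreover have "\<not> j \<sqsubseteq> c0" using cD jx D j le_trans[of j c0 x0] by auto
    ultimately have "c0 \<squnion> j = c1" using covers_join_eq[OF c] j by auto
    moreover have "c0 \<squnion> j \<sqsubseteq> u1" using le_trans[OF cm u(2)] cD m u j by (auto intro: join_le)
    moreover have "\<not> c1 \<sqsubseteq> m" using cD m D le_trans[of c1 m x0] by auto
    ultimately show "c \<sqsubseteq>\<^bsub>Cov L\<^esub> (m, u1)" using cm by (simp add: Cov_le_pair)
  qed (use m u ux ucov x y in \<open>auto simp: Cov_le_pair\<close>)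
  moreover have "v = u1"
    if v: "(m, v) \<in> covers L" "(m, v) \<sqsubseteq>\<^bsub>Cov L\<^esub> (x0, x1)" for v
  proof -
    note vD = coversD(1-4)[OF v(1)] v(2)[unfolded Cov_le_pair]
    \<comment> \<open>As for \<open>c\<close>, the top is the join of the bottom with
      \<open>j\<close>; the bottom is now \<open>m\<close>, which forces
      \<open>v = m \<squnion> j\<close>.\<close>
    have "j \<sqsubseteq> v" using leastx vD by auto
    moreover have "\<not> j \<sqsubseteq> m" using jx m D j le_trans[of j m x0] by auto
    ultimately show ?thesis using covers_join_eq[OF v(1)] j by (auto simp: u1_def)
  qed
  ultimately show thesis using ucov unfolding m_def by (intro that)
qed

lemma join_semidistributive_imp_creates_pullbacks:
  assumes jsd: "join_semidistributive L" and fin: "finite (carrier L)"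
  shows "creates_pullbacks (Cov L) L fst"
  unfolding creates_pullbacks_def
proof (intro conjI ballI allI impI)
  interpret C: partial_order "Cov L" by (rule partial_order_Cov) (rule lattice_axioms)
  show "partial_order (Cov L)" "partial_order L" ..
  show "fst \<in> carrier (Cov L) \<rightarrow> carrier L" "isotone (Cov L) L fst"
    by (rule isotone_fst_Cov[OF lattice_axioms])+
  fix x y z m
  assume A: "x \<in> carrier (Cov L)" "y \<in> carrier (Cov L)" "z \<in> carrier (Cov L)"
    "x \<sqsubseteq>\<^bsub>Cov L\<^esub> z \<and> y \<sqsubseteq>\<^bsub>Cov L\<^esub> z \<and> is_glb L m {fst x, fst y}"
  obtain x0 x1 y0 y1 z0 z1 where [simp]: "x = (x0, x1)" "y = (y0, y1)" "z = (z0, z1)"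
    by (cases x; cases y; cases z)
  have m: "m = x0 \<sqinter> y0"
    using A coversD(1)[of x0 x1] coversD(1)[of y0 y1] by (auto simp: is_glb_pair_iff)
  have cov: "(x0, x1) \<in> covers L" "(y0, y1) \<in> covers L" "(z0, z1) \<in> covers L"
    "(x0, x1) \<sqsubseteq>\<^bsub>Cov L\<^esub> (z0, z1)" "(y0, y1) \<sqsubseteq>\<^bsub>Cov L\<^esub> (z0, z1)"
    using A by auto
  obtain u1 where u: "(m, u1) \<in> covers L" "is_glb (Cov L) (m, u1) {(x0, x1), (y0, y1)}"
    and uniq: "\<And>v. (m, v) \<in> covers L \<Longrightarrow> (m, v) \<sqsubseteq>\<^bsub>Cov L\<^esub> (x0, x1) \<Longrightarrow> v = u1"
    by (rule join_semidistributive_pullback[OF jsd fin cov, folded m]) (rule that, assumption, assumption, blast)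
  have le: "(m, u1) \<sqsubseteq>\<^bsub>Cov L\<^esub> x" "(m, u1) \<sqsubseteq>\<^bsub>Cov L\<^esub> y"
    using u(2) A by (auto simp: greatest_def Lower_def)
  show "\<exists>!u. u \<in> carrier (Cov L) \<and> u \<sqsubseteq>\<^bsub>Cov L\<^esub> x \<and> u \<sqsubseteq>\<^bsub>Cov L\<^esub> y \<and> fst u = m"
  proof (rule ex1I[of _ "(m, u1)"])
    fix v assume "v \<in> carrier (Cov L) \<and> v \<sqsubseteq>\<^bsub>Cov L\<^esub> x \<and> v \<sqsubseteq>\<^bsub>Cov L\<^esub> y \<and> fst v = m"
    then show "v = (m, u1)" using uniq[of "snd v"] by (cases v) auto
  qed (use u le in auto)
  show "is_glb (Cov L) v {x, y}"
    if "v \<in> carrier (Cov L)" "v \<sqsubseteq>\<^bsub>Cov L\<^esub> x \<and> v \<sqsubseteq>\<^bsub>Cov L\<^esub> y \<and> fst v = m" for v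
    using that uniq[of "snd v"] u by (cases v) auto
qed

section \<open>Two covers without a pullback when join-semidistributivity fails\<close>

lemma creates_pullbacks_imp_join_semidistributive:
  assumes cp: "creates_pullbacks (Cov L) L fst" and fin: "finite (carrier L)"
  shows "join_semidistributive L"
  unfolding join_semidistributive_def
proof (intro ballI impI, rule ccontr)
  fix x y z
  assume c: "x \<in> carrier L" "y \<in> carrier L" "z \<in> carrier L" and eq: "x \<squnion> y = x \<squnion> z"
    and neq: "x \<squnion> (y \<sqinter> z) \<noteq> x \<squnion> y"
  define t where "t = x \<squnion> y"
  have t: "t \<in> carrier L" "x \<sqsubseteq> t" "y \<sqsubseteq> t" "z \<sqsubseteq> t"
    using c join_right[of x z] by (auto simp: t_def join_left join_right eq[symmetric])
  have "y \<sqinter> z \<sqsubseteq> t" using c t meet_left[of y z] by (auto intro: le_trans[of _ y])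
  then have "x \<squnion> (y \<sqinter> z) \<sqsubseteq> t" using c t by (auto intro: join_le)
  \<comment> \<open>Replacing \<open>x\<close> by \<open>w\<close> preserves the failure:
    \<open>y \<sqinter> z\<close> remains below \<open>w\<close>, whereas \<open>y\<close> or
    \<open>z\<close> below \<open>w\<close> would put \<open>t\<close> below
    \<open>w\<close>.\<close>
  then obtain w where w: "x \<squnion> (y \<sqinter> z) \<sqsubseteq> w" and wt: "(w, t) \<in> covers L"
    using lower_cover_above[OF fin, of "x \<squnion> (y \<sqinter> z)" t] c t neq by (auto simp: t_def)
  note wD = coversD(1-4)[OF wt]
  have xw: "x \<sqsubseteq> w" and yzw: "y \<sqinter> z \<sqsubseteq> w"
    using w wD c join_left[of x "y \<sqinter> z"] join_right[of x "y \<sqinter> z"]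
    by (auto intro: le_trans[of _ "x \<squnion> (y \<sqinter> z)"])
  have ny: "\<not> y \<sqsubseteq> w" and nz: "\<not> z \<sqsubseteq> w"
    using wD xw c join_le[of x w y] join_le[of x w z] eq by (auto simp: t_def)
  obtain y1 where y1: "y1 \<in> carrier L" "y1 \<sqsubseteq> y" "\<not> y1 \<sqsubseteq> w" "(w \<sqinter> y1, y1) \<in> covers L"
    using minimal_not_below[OF fin wD(1) c(2) ny] by blast
  obtain z1 where z1: "z1 \<in> carrier L" "z1 \<sqsubseteq> z" "\<not> z1 \<sqsubseteq> w" "(w \<sqinter> z1, z1) \<in> covers L"
    using minimal_not_below[OF fin wD(1) c(3) nz] by blast
  have le: "(w \<sqinter> y1, y1) \<sqsubseteq>\<^bsub>Cov L\<^esub> (w, t)" "(w \<sqinter> z1, z1) \<sqsubseteq>\<^bsub>Cov L\<^esub> (w, t)"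
    using y1 z1 wD t c
    by (auto simp: Cov_le_pair meet_left intro: le_trans[of _ y] le_trans[of _ z])
  let ?m = "(w \<sqinter> y1) \<sqinter> (w \<sqinter> z1)"
  have "is_glb L ?m {w \<sqinter> y1, w \<sqinter> z1}" using y1 z1 wD by (simp add: is_glb_pair_iff)
  then have "\<exists>u. u \<in> covers L \<and> u \<sqsubseteq>\<^bsub>Cov L\<^esub> (w \<sqinter> y1, y1) \<and> u \<sqsubseteq>\<^bsub>Cov L\<^esub> (w \<sqinter> z1, z1) \<and> fst u = ?m"
    using cp y1(4) z1(4) wt le unfolding creates_pullbacks_def by (fastforce dest: ex1_implies_ex)
  then obtain v where v: "(?m, v) \<in> covers L" "v \<sqsubseteq> y1" "v \<sqsubseteq> z1"
    by (auto simp: Cov_le_pair)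
  note vD = coversD(1-4)[OF v(1)]
  \<comment> \<open>Passing through \<open>y \<sqinter> z\<close> puts \<open>v\<close> below
    \<open>w\<close>. Being also below \<open>y1\<close> and \<open>z1\<close>, it falls below
    \<open>?m\<close>, the bottom of its own cover.\<close>
  have "v \<sqsubseteq> y \<sqinter> z"
    using v vD y1 z1 c by (auto intro!: meet_le intro: le_trans[of _ y1] le_trans[of _ z1])
  then have "v \<sqsubseteq> w" using yzw vD wD c by (auto intro: le_trans[of _ "y \<sqinter> z"])
  then have "v \<sqsubseteq> ?m" using v vD wD y1 z1 by (intro meet_le) auto
  then show False using vD by auto
qed

end

theorem theorem4p3:
  fixes L :: "('a, 'm) gorder_scheme"
  assumes "lattice L" and "finite (carrier L)"
  shows "join_semidistributive L \<longleftrightarrow> creates_pullbacks (Cov L) L fst"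
  using assms lattice.join_semidistributive_imp_creates_pullbacks[of L]
    lattice.creates_pullbacks_imp_join_semidistributive[of L] by blast

end
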